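(* For all integers $n \ge 0$ and $k \ge 0$, $$\sum_{i=0}^{k}\binom{n+2i}{i} \;=\; \sum_{j=0}^{\lfloor k/2 \rfloor} (-1)^{j}\binom{n+2k-j+1}{k-2j}.$$
   Context: Here $\binom{a}{b}$ denotes the ordinary binomial coefficient (an entry of Pascal's triangle), and the identity is between integers. *)

theory Defs
  imports Main
begin

end

theory Submission imports Defs begin

text \<open>
  As a coefficient of a power series, the alternating sum
  $T(m,k) = \sum_j (-1)^j \binom{m-j}{k-2j}$ is $[x^k]\,(1+x)^{m+1}/(1+x+x^2)$.
  Multiplying numerator and denominator by $1+x$ and $1+x+x^2$ yields the two recurrences
  $T(m+1,k+1) = T(m,k+1) + T(m,k)$ and $T(m+1,k+2) + T(m,k) = \binom{m+1}{k+2}$.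
  Since $(1+x)^2 - x = 1+x+x^2$, they combine to $T(m+2,k+1) - T(m,k) = \binom{m+1}{k+1}$,
  so the right-hand side $T(n+2k+1,k)$ telescopes in $k$.
\<close>

definition alt_diag_sum :: "nat \<Rightarrow> nat \<Rightarrow> int" where
  "alt_diag_sum m k = (\<Sum>j = 0..k div 2. (-1) ^ j * int ((m - j) choose (k - 2 * j)))"

lemma alt_diag_sum_0 [simp]: "alt_diag_sum m 0 = 1"
  by (simp add: alt_diag_sum_def)

lemma alt_diag_sum_1 [simp]: "alt_diag_sum m (Suc 0) = int m"
  by (simp add: alt_diag_sum_def)

text \<open>Split off \<open>j = 0\<close>; replacing \<open>j\<close> by \<open>Suc j\<close>
  elsewhere flips the sign and preserves both differences, even truncated ones.\<close>

lemma alt_diag_sum_Suc_Suc: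
  "alt_diag_sum (Suc m) (Suc (Suc k)) = int (Suc m choose Suc (Suc k)) - alt_diag_sum m k"
proof -
  have "Suc (Suc k) div 2 = Suc (k div 2)" by simp
  then show ?thesis
    unfolding alt_diag_sum_def
    by (simp only: sum.atLeast0_atMost_Suc_shift) (simp add: sum_negf del: binomial_Suc_Suc)
qed

text \<open>The bound on \<open>k\<close> keeps the subtraction \<open>m - j\<close> from truncating.\<close>

lemma alt_diag_sum_Pascal:
  "k \<le> 2 * m \<Longrightarrow>
    alt_diag_sum (Suc m) (Suc k) = alt_diag_sum m (Suc k) + alt_diag_sum m k"
proof (induction k arbitrary: m rule: induct_nat_012)
  case 0
  then show ?case by simp
next
  case 1
  then obtain m' where "m = Suc m'" by (cases m) auto
  then show ?case by (simp add: alt_diag_sum_Suc_Suc)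
next
  case (ge2 k)
  then obtain m' where m: "m = Suc m'" by (cases m) auto
  with ge2 have "alt_diag_sum m (Suc k) = alt_diag_sum m' (Suc k) + alt_diag_sum m' k"
    by simp
  \<comment> \<open>What remains is Pascal's rule for the binomials minus the induction hypothesis
    at \<open>m'\<close>.\<close>
  then show ?case by (simp add: m alt_diag_sum_Suc_Suc)
qed

lemma alt_diag_sum_diff:
  assumes "k \<le> 2 * m"
  shows "alt_diag_sum (Suc (Suc m)) (Suc k) = alt_diag_sum m k + int (Suc m choose Suc k)"
proof (cases k)
  case 0
  then show ?thesis by simp
next
  case (Suc l)
  have "alt_diag_sum (Suc (Suc m)) (Suc k) = alt_diag_sum (Suc m) (Suc k) + alt_diag_sum (Suc m) k"
    using assms by (intro alt_diag_sum_Pascal) simp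
  also have "alt_diag_sum (Suc m) k = alt_diag_sum m k + alt_diag_sum m l"
    unfolding Suc using assms Suc by (intro alt_diag_sum_Pascal) simp
  \<comment> \<open>The two occurrences of \<open>alt_diag_sum m l\<close> cancel.\<close>
  also have "alt_diag_sum (Suc m) (Suc k) = int (Suc m choose Suc k) - alt_diag_sum m l"
    unfolding Suc by (rule alt_diag_sum_Suc_Suc)
  finally show ?thesis by simp
qed

lemma sum_binomial_eq_alt_diag_sum:
  "(\<Sum>i = 0..k. int ((n + 2 * i) choose i)) = alt_diag_sum (n + 2 * k + 1) k"
proof (induction k)
  case 0
  show ?case by simp
next
  case (Suc k)
  then show ?case
    \<comment> \<open>With this \<open>m\<close>, \<open>Suc m choose Suc k\<close> is exactly the
      summand for \<open>i = Suc k\<close>.\<close>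
    using alt_diag_sum_diff[of k "n + 2 * k + 1"] by simp
qed

theorem theorem1p2:
  fixes n k :: nat
  shows "(\<Sum>i = 0..k. int ((n + 2 * i) choose i)) =
    (\<Sum>j = 0..k div 2. (-1) ^ j * int ((n + 2 * k - j + 1) choose (k - 2 * j)))"
proof -
  have "n + 2 * k + 1 - j = n + 2 * k - j + 1" if "j \<in> {0..k div 2}" for j
    using that by auto
  then show ?thesis
    unfolding sum_binomial_eq_alt_diag_sum alt_diag_sum_def by (intro sum.cong) simp_all
qed

end
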